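(* Let $\mathcal X$ be a two-dimensional real or complex normed space and let $x\in\Gamma(\mathcal X)$ be a vertex. Then the following conditions are equivalent: (i) The vertex $x$ corresponds to a smooth point in $\mathbb P(\mathcal X)$. (ii) $|x^\perp|=1$.
   Context: Let $\mathbb F\in\{\mathbb R,\mathbb C\}$ be the scalar field. For $u,v\in\mathcal X$, $u\perp v$ (Birkhoff--James orthogonality) means $\|u+\lambda v\|\ge\|u\|$ for all $\lambda\in\mathbb F$. $\Gamma(\mathcal X)$ is the directed graph whose vertex set is $\mathbb P(\mathcal X)=\{[u]=\mathbb F u : u\in\mathcal X\setminus\{0\}\}$, with an edge $[u]\rightarrow[v]$ if and only if $u\perp v$. For a vertex $x$, $x^\perp=\{y\in\Gamma(\mathcal X) : x\rightarrow y\}$. A nonzero vector $u$ is smooth if it has a unique supporting functional ($f\in\mathcal X^*$ with $\|f\|=1$, $f(u)=\|u\|$); $[u]$ is smooth if some (equivalently every) nonzero representative is smooth. *)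

theory Defs
  imports "HOL-Analysis.Analysis" "Graph_Theory.Pair_Digraph"
begin

text \<open>
  A normed space over a normed field \<open>'k\<close> (below \<open>'k\<close> is \<open>real\<close> or \<open>complex\<close>). The norm is the one
  of the type class \<^class>\<open>real_normed_vector\<close>; the scalar multiplication of \<open>'k\<close> is a parameter, since
  the class provides real scalars only. The assumption \<open>smul_of_real\<close> says that the class
  structure is obtained by restricting scalars.
\<close>

locale normed_space_over = vector_space smul
  for smul :: "'k::real_normed_field \<Rightarrow> 'a::real_normed_vector \<Rightarrow> 'a" +
  assumes smul_of_real: "smul (of_real r) x = r *\<^sub>R x"
    and norm_smul: "norm (smul c x) = norm c * norm x"

lemma normed_space_over_scaleR:
  "normed_space_over (scaleR :: real \<Rightarrow> 'a::real_normed_vector \<Rightarrow> 'a)"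
  by unfold_locales (simp_all add: scaleR_add_right scaleR_add_left)

lemma normed_space_over_complex_field: "normed_space_over ((*) :: complex \<Rightarrow> complex \<Rightarrow> complex)"
  by unfold_locales (simp_all add: algebra_simps norm_mult scaleR_conv_of_real)

definition BJ_orthogonal ::
    "('k::real_normed_field \<Rightarrow> 'a::real_normed_vector \<Rightarrow> 'a) \<Rightarrow> 'a \<Rightarrow> 'a \<Rightarrow> bool" where
  "BJ_orthogonal smul u v \<longleftrightarrow> (\<forall>c. norm (u + smul c v) \<ge> norm u)"

definition line :: "('k::real_normed_field \<Rightarrow> 'a::real_normed_vector \<Rightarrow> 'a) \<Rightarrow> 'a \<Rightarrow> 'a set" where
  "line smul u = range (\<lambda>c. smul c u)"

definition projective_space ::
    "('k::real_normed_field \<Rightarrow> 'a::real_normed_vector \<Rightarrow> 'a) \<Rightarrow> 'a set set" where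
  "projective_space smul = {line smul u | u. u \<noteq> 0}"

text \<open>
  An arc is given by some pair of orthogonal representatives; by \<open>BJ_digraph_arc_iff\<close> below
  the choice of representatives does not matter.
\<close>

definition BJ_digraph ::
    "('k::real_normed_field \<Rightarrow> 'a::real_normed_vector \<Rightarrow> 'a) \<Rightarrow> 'a set pair_pre_digraph" where
  "BJ_digraph smul =
     \<lparr> pverts = projective_space smul,
       parcs = {(line smul u, line smul v) | u v. u \<noteq> 0 \<and> v \<noteq> 0 \<and> BJ_orthogonal smul u v} \<rparr>"

definition out_nbhd :: "'v pair_pre_digraph \<Rightarrow> 'v \<Rightarrow> 'v set" where
  "out_nbhd G x = {y \<in> pverts G. x \<rightarrow>\<^bsub>G\<^esub> y}"

definition dual_space ::
    "('k::real_normed_field \<Rightarrow> 'a::real_normed_vector \<Rightarrow> 'a) \<Rightarrow> ('a \<Rightarrow> 'k) set" where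
  "dual_space smul = {f. Vector_Spaces.linear smul (*) f \<and> bounded_linear f}"

definition supporting_functional ::
    "('k::real_normed_field \<Rightarrow> 'a::real_normed_vector \<Rightarrow> 'a) \<Rightarrow> 'a \<Rightarrow> ('a \<Rightarrow> 'k) \<Rightarrow> bool" where
  "supporting_functional smul u f \<longleftrightarrow>
     f \<in> dual_space smul \<and> onorm f = 1 \<and> f u = of_real (norm u)"

definition smooth_vector ::
    "('k::real_normed_field \<Rightarrow> 'a::real_normed_vector \<Rightarrow> 'a) \<Rightarrow> 'a \<Rightarrow> bool" where
  "smooth_vector smul u \<longleftrightarrow> u \<noteq> 0 \<and> (\<exists>!f. supporting_functional smul u f)"

definition smooth_point ::
    "('k::real_normed_field \<Rightarrow> 'a::real_normed_vector \<Rightarrow> 'a) \<Rightarrow> 'a set \<Rightarrow> bool" where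
  "smooth_point smul x \<longleftrightarrow> (\<exists>u. u \<noteq> 0 \<and> x = line smul u \<and> smooth_vector smul u)"

context normed_space_over
begin

lemma line_eqD:
  assumes "line smul u = line smul u'" "u \<noteq> 0"
  obtains a where "a \<noteq> 0" "u = smul a u'"
proof -
  have "smul 1 u \<in> line smul u" unfolding line_def by (rule rangeI)
  then have "u \<in> line smul u'" using assms(1) by simp
  then obtain a where a: "u = smul a u'" unfolding line_def by auto
  then have "a \<noteq> 0" using assms(2) by auto
  with a show ?thesis using that by blast
qed

lemma BJ_orthogonal_smul:
  assumes "a \<noteq> 0" "BJ_orthogonal smul u v"
  shows "BJ_orthogonal smul (smul a u) (smul b v)"
  unfolding BJ_orthogonal_def
proof
  fix c
  have "smul a u + smul c (smul b v) = smul a (u + smul (c * b / a) v)"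
    using assms(1) by (simp add: scale_right_distrib)
  moreover have "norm u \<le> norm (u + smul (c * b / a) v)"
    using assms(2) unfolding BJ_orthogonal_def by blast
  ultimately show "norm (smul a u) \<le> norm (smul a u + smul c (smul b v))"
    by (simp add: norm_smul mult_left_mono)
qed

lemma BJ_digraph_arc_iff:
  assumes "u \<noteq> 0" "v \<noteq> 0"
  shows "line smul u \<rightarrow>\<^bsub>BJ_digraph smul\<^esub> line smul v \<longleftrightarrow> BJ_orthogonal smul u v"
proof
  assume "line smul u \<rightarrow>\<^bsub>BJ_digraph smul\<^esub> line smul v"
  then obtain u' v' where *: "line smul u = line smul u'" "line smul v = line smul v'"
      "BJ_orthogonal smul u' v'"
    by (auto simp: BJ_digraph_def)
  obtain a where "a \<noteq> 0" "u = smul a u'" using line_eqD[OF *(1) assms(1)] .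
  moreover obtain b where "b \<noteq> 0" "v = smul b v'" using line_eqD[OF *(2) assms(2)] .
  ultimately show "BJ_orthogonal smul u v" using BJ_orthogonal_smul *(3) by simp
next
  assume "BJ_orthogonal smul u v"
  then show "line smul u \<rightarrow>\<^bsub>BJ_digraph smul\<^esub> line smul v"
    using assms by (auto simp: BJ_digraph_def)
qed

end

end

theory Submission
  imports Defs
begin

text \<open>
  In a plane, a supporting functional \<open>f\<close> of \<open>u\<close> is determined by its kernel, which is a line
  \<open>\<F> v\<close> with \<open>u \<bottom> v\<close> because \<open>\<bar>f (u + c v)\<bar> = f u = \<parallel>u\<parallel>\<close>. Conversely, if \<open>u \<bottom> v\<close>, then \<open>u, v\<close> is a
  basis and \<open>a u + b v \<mapsto> a \<parallel>u\<parallel>\<close> is a supporting functional of \<open>u\<close>. So the supporting functionals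
  of \<open>u\<close> correspond bijectively to the out-neighbours of \<open>[u]\<close>, and no extension theorem is needed.
\<close>

context normed_space_over
begin

text \<open>\<open>Vector_Spaces.linear\<close> demands that its target be a vector space; for
  functionals the target is the scalar field.\<close>

lemma vector_space_field_mult: "vector_space ((*) :: 'k \<Rightarrow> 'k \<Rightarrow> 'k)"
  by unfold_locales (simp_all add: algebra_simps)

lemma linear_functional_diff_smul:
  assumes "Vector_Spaces.linear smul ((*) :: 'k \<Rightarrow> 'k \<Rightarrow> 'k) f"
  shows "f (x - smul c y) = f x - c * f y"
proof -
  have "f (x + smul (- c) y) = f x + (- c) * f y"
    using assms unfolding Vector_Spaces.linear_iff by metis
  then show ?thesis by simp
qed

text \<open>The value at \<open>u\<close> already forces \<open>onorm f\<close> to be at least 1, so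
  only the bound from above must be asked for. That bound also makes \<open>f\<close> continuous,
  and real linearity is scalar linearity restricted by \<open>smul_of_real\<close>.\<close>

lemma supporting_functional_iff:
  assumes "u \<noteq> 0"
  shows "supporting_functional smul u f \<longleftrightarrow>
    Vector_Spaces.linear smul (*) f \<and> (\<forall>x. norm (f x) \<le> norm x) \<and> f u = of_real (norm u)"
    (is "?L \<longleftrightarrow> ?R")
proof
  assume ?L
  then have "bounded_linear f" "onorm f = 1" "Vector_Spaces.linear smul (*) f"
    "f u = of_real (norm u)"
    by (auto simp: supporting_functional_def dual_space_def)
  then show ?R using onorm[of f] by simp
next
  assume R: ?R
  have bl: "bounded_linear f"
  proof (rule bounded_linear_intro[where K = 1])
    show "f (x + y) = f x + f y" for x y
      using R by (simp add: Vector_Spaces.linear_iff)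
    show "f (r *\<^sub>R x) = r *\<^sub>R f x" for r x
      using R by (simp add: Vector_Spaces.linear_iff scaleR_conv_of_real flip: smul_of_real)
  qed (use R in simp)
  have "onorm f \<le> 1"
    by (rule onorm_bound) (use R in simp_all)
  moreover have "norm u \<le> onorm f * norm u"
    using onorm[OF bl, of u] R by simp
  then have "1 \<le> onorm f" using assms by simp
  ultimately show ?L
    using R bl by (simp add: supporting_functional_def dual_space_def)
qed

lemma supporting_functional_eq_iff_kernel_eq:
  assumes "u \<noteq> 0" "supporting_functional smul u f" "supporting_functional smul u g"
    "{z. f z = 0} = {z. g z = 0}"
  shows "f = g"
proof
  fix x
  have f: "f (y - smul c u) = f y - c * of_real (norm u)"
    and g: "g (y - smul c u) = g y - c * of_real (norm u)" for y c
    using assms(1-3) by (simp_all add: supporting_functional_iff linear_functional_diff_smul)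
  \<comment> \<open>This is the projection of \<open>x\<close> onto the kernel of \<open>f\<close>
    along \<open>u\<close>. As \<open>g\<close> kills it too and takes the same value at
    \<open>u\<close>, the coefficient of \<open>u\<close> fixes \<open>g x\<close>.\<close>
  let ?z = "x - smul (f x / of_real (norm u)) u"
  have "f ?z = 0" using assms(1) f by simp
  then have "g ?z = 0" using assms(4) by blast
  then show "f x = g x" using assms(1) g by simp
qed

lemma BJ_orthogonal_notin_span:
  assumes "u \<noteq> 0" "BJ_orthogonal smul u v"
  shows "u \<notin> span {v}"
proof
  assume "u \<in> span {v}"
  then obtain c where "u = smul c v" by (auto simp: span_singleton)
  then have "norm (u + smul (- c) v) = 0" by simp
  moreover have "norm u \<le> norm (u + smul (- c) v)"
    using assms(2) unfolding BJ_orthogonal_def by blast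
  ultimately show False using assms(1) by simp
qed

lemma independent_pair:
  assumes "v \<noteq> 0" "u \<notin> span {v}"
  shows "independent {u, v}"
  using assms by (simp add: independent_insert)

lemma span_pair_eq_UNIV:
  assumes dim: "dim UNIV = 2" and "v \<noteq> 0" "u \<notin> span {v}"
  shows "span {u, v} = UNIV"
proof -
  obtain B where B: "independent B" "span B = UNIV" "card B = 2"
    using dim basis_exists[of UNIV] by (metis top.extremum_uniqueI)
  \<comment> \<open>Infinite sets have \<open>card\<close> 0, so a basis with
    \<open>card B = 2\<close> is finite.\<close>
  then have "finite B" by (simp add: card_ge_0_finite)
  interpret finite_dimensional_vector_space smul B
    by unfold_locales (use B \<open>finite B\<close> in auto)
  have "u \<noteq> v" using assms(3) by (auto intro: span_base)
  then have "UNIV \<subseteq> span {u, v}"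
    using independent_pair[OF assms(2,3)] dim by (intro card_ge_dim_independent) auto
  then show ?thesis by blast
qed

lemma pair_decomposition:
  assumes "dim UNIV = 2" "v \<noteq> 0" "u \<notin> span {v}"
  obtains a b where "z = smul a u + smul b v"
proof -
  have "z \<in> span {u, v}" using span_pair_eq_UNIV[OF assms] by simp
  then obtain a where "z - smul a u \<in> span {v}" using span_breakdown_eq by blast
  then obtain b where "z - smul a u = smul b v" by (auto simp: span_singleton)
  then show ?thesis using that[of a b] by (simp add: algebra_simps)
qed

text \<open>Since \<open>f u\<close> is nonzero, \<open>u\<close> lies off the line of
  \<open>v\<close>, so every vector is a combination of \<open>u\<close> and \<open>v\<close>;
  \<open>f\<close> sees only the coefficient of \<open>u\<close>.\<close>

lemma kernel_supporting_functional_eq_line: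
  assumes "dim UNIV = 2" "u \<noteq> 0" "supporting_functional smul u f" "v \<noteq> 0" "f v = 0"
  shows "{z. f z = 0} = line smul v"
proof -
  have lin: "Vector_Spaces.linear smul (*) f" and fu: "f u = of_real (norm u)"
    using assms(2,3) by (auto simp: supporting_functional_iff)
  have f: "f (smul a u + smul b v) = a * of_real (norm u)" for a b
    using lin fu assms(5) by (simp add: Vector_Spaces.linear_iff)
  have f0: "f (smul b v) = 0" for b
    using lin assms(5) by (simp add: Vector_Spaces.linear_iff)
  then have "u \<notin> span {v}" using fu assms(2) by (auto simp: span_singleton)
  then have "z \<in> line smul v" if "f z = 0" for z
    using pair_decomposition[OF assms(1,4), of u z] that f assms(2)
    by (metis line_def rangeI add_0 mult_eq_0_iff norm_eq_zero of_real_eq_0_iff scale_zero_left)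
  then show ?thesis using f0 by (auto simp: line_def)
qed

lemma out_nbhd_BJ_digraph:
  assumes "u \<noteq> 0"
  shows "out_nbhd (BJ_digraph smul) (line smul u) = {line smul v | v. v \<noteq> 0 \<and> BJ_orthogonal smul u v}"
proof -
  have "pverts (BJ_digraph smul) = projective_space smul"
    by (simp add: BJ_digraph_def)
  then show ?thesis
    using BJ_digraph_arc_iff[OF assms] by (auto simp: out_nbhd_def projective_space_def)
qed

lemma kernel_supporting_functional_in_out_nbhd:
  assumes dim: "dim UNIV = 2" and "u \<noteq> 0" and sf: "supporting_functional smul u f"
  shows "{z. f z = 0} \<in> out_nbhd (BJ_digraph smul) (line smul u)"
proof -
  have lin: "Vector_Spaces.linear smul (*) f" and fu: "f u = of_real (norm u)"
    and le: "\<And>x. norm (f x) \<le> norm x"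
    using assms(2) sf by (auto simp: supporting_functional_iff)
  have "span {u} \<noteq> UNIV"
  proof
    assume "span {u} = UNIV"
    then have "dim UNIV = card {u}"
      using assms(2) by (intro dim_eq_card) auto
    then show False using dim by simp
  qed
  then obtain w where w: "w \<notin> span {u}" by blast
  \<comment> \<open>A nonzero kernel vector is obtained by projecting \<open>w\<close> along
    \<open>u\<close>; it cannot vanish because \<open>w\<close> is not a multiple of
    \<open>u\<close>.\<close>
  define v where "v = w - smul (f w / of_real (norm u)) u"
  have "v \<noteq> 0" using w by (auto simp: v_def span_singleton)
  have "f v = f w - (f w / of_real (norm u)) * f u"
    unfolding v_def using lin by (rule linear_functional_diff_smul)
  then have fv: "f v = 0" using fu assms(2) by simp
  have "norm u \<le> norm (u + smul c v)" for c
  proof -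
    have "f (u + smul c v) = of_real (norm u)"
      using lin fu fv by (simp add: Vector_Spaces.linear_iff)
    then show ?thesis using le[of "u + smul c v"] by simp
  qed
  then have "BJ_orthogonal smul u v" by (simp add: BJ_orthogonal_def)
  then show ?thesis
    using kernel_supporting_functional_eq_line[OF dim assms(2) sf \<open>v \<noteq> 0\<close> fv] \<open>v \<noteq> 0\<close>
    by (auto simp: out_nbhd_BJ_digraph[OF assms(2)])
qed

lemma BJ_orthogonal_imp_supporting_functional:
  assumes dim: "dim UNIV = 2" and "u \<noteq> 0" "v \<noteq> 0" and orth: "BJ_orthogonal smul u v"
  obtains f where "supporting_functional smul u f" "f v = 0"
proof -
  have nin: "u \<notin> span {v}" using BJ_orthogonal_notin_span[OF assms(2) orth] .
  then have "u \<noteq> v" by (auto intro: span_base)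
  note ind = independent_pair[OF assms(3) nin]
  note UNIV = span_pair_eq_UNIV[OF dim assms(3) nin]
  define f where "f z = representation {u, v} z u * of_real (norm u)" for z
  have lin: "Vector_Spaces.linear smul (*) f"
    using vector_space_axioms vector_space_field_mult ind UNIV
    by (simp add: Vector_Spaces.linear_iff f_def representation_add representation_scale
        distrib_right)
  have fu: "f u = of_real (norm u)" and fv: "f v = 0"
    using ind \<open>u \<noteq> v\<close> by (simp_all add: f_def representation_basis)
  have "norm (f z) \<le> norm z" for z
  proof -
    obtain a b where z: "z = smul a u + smul b v"
      using pair_decomposition[OF dim assms(3) nin] .
    have fz: "f z = a * of_real (norm u)"
      using lin fu fv z by (simp add: Vector_Spaces.linear_iff)
    show ?thesis
    proof (cases "a = 0")
      case False
      \<comment> \<open>Orthogonality passes to the multiples \<open>smul a u\<close> and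
        \<open>smul b v\<close> when \<open>a\<close> is nonzero; the scalar 1 then gives the bound
        on \<open>f z\<close>.\<close>
      have "norm (smul a u) \<le> norm (smul a u + smul 1 (smul b v))"
        using BJ_orthogonal_smul[OF False orth] unfolding BJ_orthogonal_def by blast
      then show ?thesis using fz z by (simp add: norm_smul norm_mult)
    qed (simp add: fz)
  qed
  then have "supporting_functional smul u f"
    using lin fu assms(2) by (simp add: supporting_functional_iff)
  then show ?thesis using fv that by blast
qed

text \<open>Vertices are lines taken as sets of vectors, so a kernel is itself a vertex and no
  choice of a spanning vector enters the map.\<close>

lemma bij_betw_supporting_functional_out_nbhd:
  assumes dim: "dim UNIV = 2" and "u \<noteq> 0"
  shows "bij_betw (\<lambda>f. {z. f z = 0}) {f. supporting_functional smul u f}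
    (out_nbhd (BJ_digraph smul) (line smul u))"
proof (rule bij_betwI')
  show "\<exists>f \<in> {f. supporting_functional smul u f}. y = {z. f z = 0}"
    if y: "y \<in> out_nbhd (BJ_digraph smul) (line smul u)" for y
  proof -
    obtain v where v: "y = line smul v" "v \<noteq> 0" "BJ_orthogonal smul u v"
      using y by (auto simp: out_nbhd_BJ_digraph[OF assms(2)])
    obtain f where "supporting_functional smul u f" "f v = 0"
      using BJ_orthogonal_imp_supporting_functional[OF assms v(2,3)] .
    then show ?thesis
      using kernel_supporting_functional_eq_line[OF assms _ v(2)] v(1) by auto
  qed
qed (use assms supporting_functional_eq_iff_kernel_eq
    kernel_supporting_functional_in_out_nbhd in auto)

theorem smooth_point_iff_card_out_nbhd:
  assumes dim: "dim UNIV = 2" and "x \<in> pverts (BJ_digraph smul)"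
  shows "smooth_point smul x \<longleftrightarrow> card (out_nbhd (BJ_digraph smul) x) = 1"
proof -
  \<comment> \<open>Proved for every representative, since \<open>smooth_point\<close> only provides
    some representative, perhaps not the chosen one.\<close>
  have *: "smooth_vector smul u \<longleftrightarrow> card (out_nbhd (BJ_digraph smul) (line smul u)) = 1"
    if "u \<noteq> 0" for u
  proof -
    \<comment> \<open>Cardinality 1 excludes infinite sets, whose \<open>card\<close> is 0, and so
      expresses unique existence.\<close>
    have "smooth_vector smul u \<longleftrightarrow> card {f. supporting_functional smul u f} = 1"
      using that by (auto simp: smooth_vector_def card_1_singleton_iff Ex1_def)
    also have "card {f. supporting_functional smul u f} =
        card (out_nbhd (BJ_digraph smul) (line smul u))"
      using bij_betw_same_card[OF bij_betw_supporting_functional_out_nbhd[OF dim that]] .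
    finally show ?thesis .
  qed
  obtain u where "u \<noteq> 0" "x = line smul u"
    using assms(2) by (auto simp: BJ_digraph_def projective_space_def)
  then show ?thesis using * unfolding smooth_point_def by blast
qed

end

theorem lemma2p7:
  fixes smul :: "complex \<Rightarrow> 'b::real_normed_vector \<Rightarrow> 'b"
  shows
    "(vector_space.dim (scaleR :: real \<Rightarrow> 'a::real_normed_vector \<Rightarrow> 'a) UNIV = 2 \<longrightarrow>
       (\<forall>x \<in> pverts (BJ_digraph (scaleR :: real \<Rightarrow> 'a \<Rightarrow> 'a)).
          smooth_point (scaleR :: real \<Rightarrow> 'a \<Rightarrow> 'a) x \<longleftrightarrow>
          card (out_nbhd (BJ_digraph (scaleR :: real \<Rightarrow> 'a \<Rightarrow> 'a)) x) = 1))
     \<and>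
     (normed_space_over smul \<and> vector_space.dim smul UNIV = 2 \<longrightarrow>
       (\<forall>x \<in> pverts (BJ_digraph smul).
          smooth_point smul x \<longleftrightarrow> card (out_nbhd (BJ_digraph smul) x) = 1))"
  \<comment> \<open>Over the reals \<open>scaleR\<close> satisfies the locale axioms outright; over
    the complex numbers they are a hypothesis.\<close>
  using normed_space_over.smooth_point_iff_card_out_nbhd
    normed_space_over.smooth_point_iff_card_out_nbhd[OF normed_space_over_scaleR]
  by blast

end
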